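(* Let $\sigma_\xi>0$ and $\rho\in(-1,0)$, and let $(Y_t)_{t\ge1}$ be the gaussian convolution-based Markov process with parameters $\rho$ and $\sigma_\xi$ defined in the context. Then for every integer $k\ge1$ the $k$-th order autocorrelation function of $(Y_t)_{t\ge1}$ satisfies $$\lim_{t\to+\infty}\operatorname{corr}(Y_t,Y_{t+k})=(1-2\rho^2)^k.$$
   Context: The gaussian convolution-based Markov process with parameters $\rho$ and $\sigma_\xi$ is a real-valued discrete-time Markov process $(Y_t)_{t\geq 0}$ satisfying $$Y_t=Y_{t-1}+\xi_t\quad(t\ge1),\qquad Y_0=0,$$ where the innovations $(\xi_t)_{t\ge1}$ are identically distributed, gaussian, with mean zero and standard deviation $\sigma_\xi$, and where, for every $t\ge2$, the copula of the pair $(Y_{t-1},\xi_t)$ is the bivariate gaussian copula with the same (time-invariant) correlation parameter $\rho$. In particular $Y_1=\xi_1$. The gaussian copula with parameter $\rho$ is the copula of a bivariate normal vector with standard normal margins and correlation $\rho$; the copula $C$ of a pair $(X,Z)$ is given by Sklar's theorem: $P(X\le x,Z\le z)=C(F_X(x),F_Z(z))$. The $k$-th order autocorrelation function of $(Y_t)_{t\geq 1}$ is $t\mapsto\operatorname{corr}(Y_t,Y_{t+k})$. *)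

theory Defs
  imports "HOL-Probability.Probability"
begin

definition corr :: "'a measure \<Rightarrow> ('a \<Rightarrow> real) \<Rightarrow> ('a \<Rightarrow> real) \<Rightarrow> real" where
  "corr M X Z =
     prob_space.expectation M
       (\<lambda>w. (X w - prob_space.expectation M X) * (Z w - prob_space.expectation M Z))
     / (sqrt (prob_space.variance M X) * sqrt (prob_space.variance M Z))"

definition is_copula :: "(real \<Rightarrow> real \<Rightarrow> real) \<Rightarrow> bool" where
  "is_copula C \<longleftrightarrow>
     (\<forall>u\<in>{0..1}. C u 0 = 0 \<and> C 0 u = 0 \<and> C u 1 = u \<and> C 1 u = u) \<and>
     (\<forall>u\<in>{0..1}. \<forall>u'\<in>{0..1}. \<forall>v\<in>{0..1}. \<forall>v'\<in>{0..1}. u \<le> u' \<longrightarrow> v \<le> v' \<longrightarrow>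
        0 \<le> C u' v' - C u' v - C u v' + C u v)"

(* Sklar's relation.  A copula is a function on the unit square; here C is a total function,
   of which only the values on the unit square matter. *)
definition is_copula_of ::
    "(real \<Rightarrow> real \<Rightarrow> real) \<Rightarrow> 'a measure \<Rightarrow> ('a \<Rightarrow> real) \<Rightarrow> ('a \<Rightarrow> real) \<Rightarrow> bool" where
  "is_copula_of C M X Z \<longleftrightarrow> is_copula C \<and>
     (\<forall>x z. measure M {w \<in> space M. X w \<le> x \<and> Z w \<le> z}
            = C (cdf (distr M borel X) x) (cdf (distr M borel Z) z))"

(* Law of a bivariate normal vector with standard normal margins and correlation rho,
   meaningful for -1 < rho < 1. *)
definition std_bivariate_normal :: "real \<Rightarrow> (real \<times> real) measure" where
  "std_bivariate_normal \<rho> = density lborel (\<lambda>(x, z). ennreal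
     (1 / (2 * pi * sqrt (1 - \<rho>\<^sup>2)) *
      exp (- (x\<^sup>2 - 2 * \<rho> * x * z + z\<^sup>2) / (2 * (1 - \<rho>\<^sup>2)))))"

(* The margins being continuous, this determines C on the unit square. *)
definition is_gaussian_copula :: "real \<Rightarrow> (real \<Rightarrow> real \<Rightarrow> real) \<Rightarrow> bool" where
  "is_gaussian_copula \<rho> C \<longleftrightarrow> is_copula_of C (std_bivariate_normal \<rho>) fst snd"

definition generated_algebra ::
    "'a measure \<Rightarrow> (nat \<Rightarrow> 'a \<Rightarrow> real) \<Rightarrow> nat set \<Rightarrow> 'a measure" where
  "generated_algebra M Y I =
     sigma (space M) (\<Union>i\<in>I. {Y i -` B \<inter> space M | B. B \<in> sets borel})"

(* P(Y_{t+1} in B | Y_0, ..., Y_t) = P(Y_{t+1} in B | Y_t) almost surely *)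
definition markov_process :: "'a measure \<Rightarrow> (nat \<Rightarrow> 'a \<Rightarrow> real) \<Rightarrow> bool" where
  "markov_process M Y \<longleftrightarrow>
     (\<forall>t. Y t \<in> borel_measurable M) \<and>
     (\<forall>t. \<forall>B\<in>sets borel. AE w in M.
        real_cond_exp M (generated_algebra M Y {..t}) (indicator (Y (Suc t) -` B \<inter> space M)) w
        = real_cond_exp M (generated_algebra M Y {t}) (indicator (Y (Suc t) -` B \<inter> space M)) w)"

(* \<xi> 0 is irrelevant: the innovations are indexed from 1.  The copula C is chosen before t
   because it is time-invariant. *)
locale gaussian_convolution_process = prob_space M
  for M :: "'a measure" and Y \<xi> :: "nat \<Rightarrow> 'a \<Rightarrow> real" and \<rho> \<sigma>\<^sub>\<xi> :: real +
  assumes markov: "markov_process M Y"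
    and start: "\<And>w. w \<in> space M \<Longrightarrow> Y 0 w = 0"
    and step: "\<And>t w. 1 \<le> t \<Longrightarrow> w \<in> space M \<Longrightarrow> Y t w = Y (t - 1) w + \<xi> t w"
    and innovation: "\<And>t. 1 \<le> t \<Longrightarrow> distributed M lborel (\<xi> t) (normal_density 0 \<sigma>\<^sub>\<xi>)"
    and dependence: "\<exists>C. is_gaussian_copula \<rho> C \<and> (\<forall>t\<ge>2. is_copula_of C M (Y (t - 1)) (\<xi> t))"

end

theory Submission
  imports Defs
begin

text \<open>Only marginal laws and copulas are prescribed, so the first task is to recover joint laws. A joint law is
determined by its margins and its copula; hence, if \<open>Y\<^sub>t\<close> is centred normal with standard deviation
\<open>s\<^sub>t\<close>, the pair \<open>(Y\<^sub>t, \<xi>\<^sub>t\<^sub>+\<^sub>1)\<close> is bivariate normal with correlation \<open>\<rho>\<close>. Splitting off the part of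
the innovation that is independent of \<open>Y\<^sub>t\<close>,
\<open>\<xi>\<^sub>t\<^sub>+\<^sub>1 = (\<rho> \<sigma> / s\<^sub>t) Y\<^sub>t + \<sigma> sqrt (1 - \<rho>\<^sup>2) W\<close> (lemma \<open>gaussian_copula_regression\<close>), yields two
things: \<open>Y\<^sub>t\<^sub>+\<^sub>1\<close> is again normal, with \<open>s\<^sub>t\<^sub>+\<^sub>1\<^sup>2 = s\<^sub>t\<^sup>2 + 2 \<rho> \<sigma> s\<^sub>t + \<sigma>\<^sup>2\<close>, and the best
prediction of \<open>Y\<^sub>t\<^sub>+\<^sub>1\<close> from \<open>Y\<^sub>t\<close> is \<open>(1 + \<rho> \<sigma> / s\<^sub>t) Y\<^sub>t\<close>.

By the Markov property this is also the best prediction from the whole past, so each further step multiplies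
the covariance with \<open>Y\<^sub>t\<close> by one such factor. Therefore
\<open>corr (Y\<^sub>t, Y\<^sub>t\<^sub>+\<^sub>k) = s\<^sub>t / s\<^sub>t\<^sub>+\<^sub>k * (\<Prod>j<k. 1 + \<rho> \<sigma> / s\<^sub>t\<^sub>+\<^sub>j)\<close> (lemma \<open>corr_eq\<close>).

For negative \<open>\<rho>\<close> the recursion for \<open>s\<^sub>t\<close> has the positive fixed point \<open>- \<sigma> / (2 \<rho>)\<close>, where the
variance of the innovation offsets twice its negative covariance with the current value, and it contracts
towards it (lemma \<open>marginal_sd_tendsto\<close>). In the limit the quotient of standard deviations is \<open>1\<close> and each
factor is \<open>1 + \<rho> \<sigma> * (- 2 \<rho> / \<sigma>) = 1 - 2 \<rho>\<^sup>2\<close>.\<close>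

section \<open>Joint laws with a given copula\<close>

text \<open>Two-dimensional counterpart of the fact that a distribution function determines its law: lower
quadrants are the order intervals below a point of the plane, so they generate the Borel sets and are closed
under intersection.\<close>
lemma prob_measure_eqI_lower_quadrants:
  fixes P Q :: "(real \<times> real) measure"
  assumes P: "prob_space P" "sets P = sets borel" and Q: "prob_space Q" "sets Q = sets borel"
    and eq: "\<And>x z. measure P ({..x} \<times> {..z}) = measure Q ({..x} \<times> {..z})"
  shows "P = Q"
proof -
  interpret P: prob_space P by fact
  interpret Q: prob_space Q by fact
  have atMost_pair: "{..a} = {..fst a} \<times> {..snd a}" for a :: "real \<times> real"
    by (auto simp: less_eq_prod_def)
  have borel: "sets (borel :: (real \<times> real) measure) = sigma_sets UNIV (range atMost)"
    by (subst borel_eq_atMost) simp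
  show ?thesis
  proof (rule measure_eqI_generator_eq[where E = "range atMost" and \<Omega> = UNIV
        and A = "\<lambda>n. {..(real n, real n)}"])
    show "Int_stable (range (atMost :: real \<times> real \<Rightarrow> _))"
    proof (rule Int_stableI, safe)
      fix a b c d :: real
      have "{..(a, b)} \<inter> {..(c, d)} = {..(min a c, min b d)}"
        by (auto simp: less_eq_prod_def)
      then show "{..(a, b)} \<inter> {..(c, d)} \<in> range atMost" by auto
    qed
    show "emeasure P X = emeasure Q X" if "X \<in> range atMost" for X
      using that eq by (auto simp: P.emeasure_eq_measure Q.emeasure_eq_measure atMost_pair)
    show "(\<Union>n. {..(real n, real n)}) = UNIV"
    proof (intro equalityI subset_UNIV subsetI)
      fix a :: "real \<times> real"
      obtain n where "max (fst a) (snd a) \<le> real n" using real_arch_simple by blast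
      then show "a \<in> (\<Union>n. {..(real n, real n)})" by (auto simp: less_eq_prod_def)
    qed
  qed (use P Q borel in auto)
qed

text \<open>Copulas ignore positive rescaling of the margins, so normal margins can be standardised.\<close>
lemma is_copula_of_scale:
  assumes C: "is_copula_of C M X Z" and pos: "a > 0" "b > 0"
    and [measurable]: "X \<in> borel_measurable M" "Z \<in> borel_measurable M"
  shows "is_copula_of C M (\<lambda>w. a * X w) (\<lambda>w. b * Z w)"
proof -
  have cdf_scale: "cdf (distr M borel (\<lambda>w. r * V w)) x = cdf (distr M borel V) (x / r)"
    if "r > 0" "V \<in> borel_measurable M" for r x :: real and V
    using that by (auto simp: cdf_def measure_distr field_simps intro!: arg_cong[where f = "measure M"])
  have "{w \<in> space M. a * X w \<le> x \<and> b * Z w \<le> z} = {w \<in> space M. X w \<le> x / a \<and> Z w \<le> z / b}" for x z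
    using pos by (auto simp: field_simps)
  then show ?thesis
    using C pos by (simp add: is_copula_of_def cdf_scale)
qed

text \<open>Sklar's relation expresses the joint distribution function through the copula and the marginal
distribution functions alone.\<close>
lemma distr_pair_eq_if_same_copula:
  assumes "prob_space M" "prob_space N"
    and C: "is_copula_of C M X Z" "is_copula_of C N X' Z'"
    and [measurable]: "X \<in> borel_measurable M" "Z \<in> borel_measurable M"
      "X' \<in> borel_measurable N" "Z' \<in> borel_measurable N"
    and margins: "distr M borel X = distr N borel X'" "distr M borel Z = distr N borel Z'"
  shows "distr M borel (\<lambda>w. (X w, Z w)) = distr N borel (\<lambda>w. (X' w, Z' w))"
proof (rule prob_measure_eqI_lower_quadrants)
  interpret M: prob_space M by fact
  interpret N: prob_space N by fact
  have [measurable]: "(\<lambda>w. (X w, Z w)) \<in> borel_measurable M" "(\<lambda>w. (X' w, Z' w)) \<in> borel_measurable N"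
    by (simp_all add: borel_prod[symmetric])
  show "prob_space (distr M borel (\<lambda>w. (X w, Z w)))" "prob_space (distr N borel (\<lambda>w. (X' w, Z' w)))"
    by (simp_all add: M.prob_space_distr N.prob_space_distr)
  fix x z :: real
  have "{..x} \<times> {..z} \<in> sets (borel \<Otimes>\<^sub>M borel)" by simp
  then have [measurable]: "{..x} \<times> {..z} \<in> sets borel" unfolding borel_prod .
  have "measure M {w \<in> space M. X w \<le> x \<and> Z w \<le> z} = measure N {w \<in> space N. X' w \<le> x \<and> Z' w \<le> z}"
    using C margins by (simp add: is_copula_of_def)
  moreover have "(\<lambda>w. (X w, Z w)) -` ({..x} \<times> {..z}) \<inter> space M = {w \<in> space M. X w \<le> x \<and> Z w \<le> z}"
    "(\<lambda>w. (X' w, Z' w)) -` ({..x} \<times> {..z}) \<inter> space N = {w \<in> space N. X' w \<le> x \<and> Z' w \<le> z}" by auto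
  ultimately show "measure (distr M borel (\<lambda>w. (X w, Z w))) ({..x} \<times> {..z})
      = measure (distr N borel (\<lambda>w. (X' w, Z' w))) ({..x} \<times> {..z})"
    by (simp add: measure_distr)
qed simp_all

section \<open>The bivariate normal law\<close>

text \<open>Completing the square, \<open>x\<^sup>2 - 2 \<rho> x z + z\<^sup>2 = (1 - \<rho>\<^sup>2) (x\<^sup>2 + w\<^sup>2)\<close> for
\<open>z = \<rho> x + sqrt (1 - \<rho>\<^sup>2) w\<close>: the shear that removes the correlation turns the density into a
product of two standard normal densities. The Jacobian of the substitution cancels the normalising factor.\<close>
lemma std_bivariate_normal_eq_distr:
  assumes "-1 < \<rho>" "\<rho> < 1"
  shows "std_bivariate_normal \<rho> =
    distr (std_normal_distribution \<Otimes>\<^sub>M std_normal_distribution) borel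
      (\<lambda>(x, w). (x, \<rho> * x + sqrt (1 - \<rho>\<^sup>2) * w))"
proof (rule measure_eqI)
  define c where "c = sqrt (1 - \<rho>\<^sup>2)"
  have "\<rho>\<^sup>2 < 1" using assms by (simp add: abs_square_less_1)
  then have c: "c > 0" "c\<^sup>2 = 1 - \<rho>\<^sup>2" by (auto simp: c_def)
  let ?g = "\<lambda>x z. 1 / (2 * pi * c) * exp (- (x\<^sup>2 - 2 * \<rho> * x * z + z\<^sup>2) / (2 * c\<^sup>2))"
  have dens: "c * ?g x (\<rho> * x + c * w) = std_normal_density x * std_normal_density w" for x w
  proof -
    have "x\<^sup>2 - 2 * \<rho> * x * (\<rho> * x + c * w) + (\<rho> * x + c * w)\<^sup>2 = (1 - \<rho>\<^sup>2) * x\<^sup>2 + c\<^sup>2 * w\<^sup>2"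
      by (simp add: power2_eq_square algebra_simps)
    also have "\<dots> = c\<^sup>2 * (x\<^sup>2 + w\<^sup>2)"
      unfolding c(2)[symmetric] by (simp add: algebra_simps)
    finally have "x\<^sup>2 - 2 * \<rho> * x * (\<rho> * x + c * w) + (\<rho> * x + c * w)\<^sup>2 = c\<^sup>2 * (x\<^sup>2 + w\<^sup>2)" .
    moreover have "std_normal_density x * std_normal_density w
        = 1 / (2 * pi) * exp (- (x\<^sup>2 + w\<^sup>2) / 2)"
      by (simp add: normal_density_def exp_add[symmetric] field_simps)
    moreover have "- (c\<^sup>2 * (x\<^sup>2 + w\<^sup>2)) / (2 * c\<^sup>2) = - (x\<^sup>2 + w\<^sup>2) / 2"
      using c(1) by (simp add: divide_simps)
    ultimately show ?thesis using c(1) by simp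
  qed
  interpret N: prob_space "std_normal_distribution"
    by (rule prob_space_normal_density) simp
  have sgf: "sigma_finite_measure (std_normal_distribution)" ..
  show "sets (std_bivariate_normal \<rho>) = sets (distr (std_normal_distribution \<Otimes>\<^sub>M
      std_normal_distribution) borel (\<lambda>(x, w). (x, \<rho> * x + sqrt (1 - \<rho>\<^sup>2) * w)))"
    by (simp add: std_bivariate_normal_def)
  fix A assume "A \<in> sets (std_bivariate_normal \<rho>)"
  then have A[measurable]: "A \<in> sets (borel \<Otimes>\<^sub>M borel)"
    by (simp only: std_bivariate_normal_def sets_density sets_lborel borel_prod)
  have std_eq: "std_bivariate_normal \<rho>
      = density (lborel \<Otimes>\<^sub>M lborel) (\<lambda>p. ennreal (?g (fst p) (snd p)))"
    unfolding c(2) unfolding std_bivariate_normal_def c_def lborel_prod case_prod_beta ..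
  have "emeasure (std_bivariate_normal \<rho>) A
      = (\<integral>\<^sup>+p. ennreal (?g (fst p) (snd p)) * indicator A p \<partial>(lborel \<Otimes>\<^sub>M lborel))"
    unfolding std_eq by (subst emeasure_density) auto
  also have "\<dots> = (\<integral>\<^sup>+x. \<integral>\<^sup>+z. ennreal (?g x z) * indicator A (x, z) \<partial>lborel \<partial>lborel)"
    by (subst lborel.nn_integral_fst[symmetric]) auto
  also have "\<dots> = (\<integral>\<^sup>+x. \<integral>\<^sup>+w. ennreal (std_normal_density x * std_normal_density w)
      * indicator A (x, \<rho> * x + c * w) \<partial>lborel \<partial>lborel)"
  proof (rule nn_integral_cong)
    fix x :: real
    have "(\<integral>\<^sup>+z. ennreal (?g x z) * indicator A (x, z) \<partial>lborel)
      = ennreal c * (\<integral>\<^sup>+w. ennreal (?g x (\<rho> * x + c * w)) * indicator A (x, \<rho> * x + c * w) \<partial>lborel)"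
      using c(1) by (subst nn_integral_real_affine[where c = c and t = "\<rho> * x"]) auto
    also have "\<dots> = (\<integral>\<^sup>+w. ennreal (std_normal_density x * std_normal_density w)
      * indicator A (x, \<rho> * x + c * w) \<partial>lborel)"
    proof (subst nn_integral_cmult[symmetric])
      have "ennreal c * ennreal (?g x (\<rho> * x + c * w))
          = ennreal (std_normal_density x * std_normal_density w)" for w
        unfolding dens[symmetric] by (rule ennreal_mult[symmetric]) (use c(1) in auto)
      then show "(\<integral>\<^sup>+w. ennreal c * (ennreal (?g x (\<rho> * x + c * w)) * indicator A (x, \<rho> * x + c * w)) \<partial>lborel)
          = (\<integral>\<^sup>+w. ennreal (std_normal_density x * std_normal_density w)
              * indicator A (x, \<rho> * x + c * w) \<partial>lborel)"
        unfolding mult.assoc[symmetric] by (simp only:)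
    qed measurable
    finally show "(\<integral>\<^sup>+z. ennreal (?g x z) * indicator A (x, z) \<partial>lborel) = \<dots>" .
  qed
  also have "\<dots> = (\<integral>\<^sup>+p. ennreal (std_normal_density (fst p) * std_normal_density (snd p))
      * indicator A (fst p, \<rho> * fst p + c * snd p) \<partial>(lborel \<Otimes>\<^sub>M lborel))"
    by (subst lborel.nn_integral_fst[symmetric]) auto
  also have "\<dots> = (\<integral>\<^sup>+p. indicator A (fst p, \<rho> * fst p + c * snd p)
      \<partial>(std_normal_distribution \<Otimes>\<^sub>M std_normal_distribution))"
    by (subst pair_measure_density[OF _ _ _ sgf])
       (auto simp: nn_integral_density ennreal_mult' case_prod_beta lborel.sigma_finite_measure_axioms)
  also have "\<dots> = emeasure (distr (std_normal_distribution \<Otimes>\<^sub>M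
      std_normal_distribution) borel (\<lambda>(x, w). (x, \<rho> * x + c * w))) A"
    unfolding borel_prod[symmetric]
    by (subst nn_integral_indicator[where A = A, symmetric])
       (auto simp: nn_integral_distr case_prod_beta simp del: nn_integral_indicator)
  finally show "emeasure (std_bivariate_normal \<rho>) A = emeasure (distr (std_normal_distribution
      \<Otimes>\<^sub>M std_normal_distribution) borel (\<lambda>(x, w). (x, \<rho> * x + sqrt (1 - \<rho>\<^sup>2) * w))) A"
    unfolding c_def .
qed

lemma prob_space_std_bivariate_normal:
  assumes "-1 < \<rho>" "\<rho> < 1"
  shows "prob_space (std_bivariate_normal \<rho>)"
proof -
  interpret N: prob_space "std_normal_distribution"
    by (rule prob_space_normal_density) simp
  interpret NN: pair_prob_space "std_normal_distribution" "std_normal_distribution" ..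
  show ?thesis
    unfolding std_bivariate_normal_eq_distr[OF assms]
    by (rule NN.prob_space_distr) (simp add: case_prod_beta borel_prod[symmetric])
qed

lemma distr_fst_std_bivariate_normal:
  assumes "-1 < \<rho>" "\<rho> < 1"
  shows "distr (std_bivariate_normal \<rho>) borel fst = std_normal_distribution"
proof -
  interpret N: prob_space "std_normal_distribution"
    by (rule prob_space_normal_density) simp
  have "distr (std_bivariate_normal \<rho>) borel fst = distr
      (std_normal_distribution \<Otimes>\<^sub>M std_normal_distribution) borel fst"
    unfolding std_bivariate_normal_eq_distr[OF assms]
    by (subst distr_distr) (auto simp: case_prod_beta comp_def borel_prod[symmetric])
  also have "\<dots> = distr
      (std_normal_distribution \<Otimes>\<^sub>M std_normal_distribution)
       (std_normal_distribution) fst"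
    by (rule distr_cong) auto
  finally show ?thesis
    by (simp add: N.distr_pair_fst)
qed

text \<open>The density is symmetric in its two arguments, which reduces the second margin to the first.\<close>
lemma distr_swap_std_bivariate_normal:
  "distr (std_bivariate_normal \<rho>) borel prod.swap = std_bivariate_normal \<rho>"
proof -
  have lborel_swap: "(lborel :: (real \<times> real) measure) = distr lborel lborel prod.swap"
    using lborel_pair.distr_pair_swap[where ?'a = real and ?'b = real]
    unfolding lborel_prod prod.swap_def[abs_def] case_prod_beta .
  have swap: "prod.swap \<in> measurable borel (borel :: (real \<times> real) measure)"
    by (simp add: borel_prod[symmetric] prod.swap_def[abs_def])
  let ?g = "\<lambda>(x, z). ennreal (1 / (2 * pi * sqrt (1 - \<rho>\<^sup>2)) *
      exp (- (x\<^sup>2 - 2 * \<rho> * x * z + z\<^sup>2) / (2 * (1 - \<rho>\<^sup>2))))"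
  have g: "?g \<in> borel_measurable lborel"
    by (simp add: borel_prod[symmetric])
  have "density lborel ?g = density (distr lborel lborel prod.swap) ?g"
    by (subst lborel_swap) simp
  also have "\<dots> = distr (density lborel (\<lambda>p. ?g (prod.swap p))) lborel prod.swap"
    by (rule density_distr) (use g swap in simp_all)
  also have "(\<lambda>p. ?g (prod.swap p)) = ?g"
    by (auto simp: fun_eq_iff algebra_simps)
  finally show ?thesis
    unfolding std_bivariate_normal_def
    by (metis (no_types, lifting) distr_cong sets_lborel)
qed

lemma distr_snd_std_bivariate_normal:
  assumes "-1 < \<rho>" "\<rho> < 1"
  shows "distr (std_bivariate_normal \<rho>) borel snd = std_normal_distribution"
proof -
  have [measurable_cong]: "sets (std_bivariate_normal \<rho>) = sets borel"
    by (simp add: std_bivariate_normal_def)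
  have [measurable]: "fst \<in> borel_measurable (borel :: (real \<times> real) measure)"
    by (simp add: borel_prod[symmetric])
  have [measurable]: "prod.swap \<in> borel_measurable (std_bivariate_normal \<rho>)"
    by (simp add: std_bivariate_normal_def borel_prod[symmetric] prod.swap_def[abs_def])
  have "distr (std_bivariate_normal \<rho>) borel snd
      = distr (distr (std_bivariate_normal \<rho>) borel prod.swap) borel fst"
    by (subst distr_distr) (auto simp: comp_def intro: borel_measurable_continuous_onI)
  then show ?thesis
    by (simp add: distr_swap_std_bivariate_normal distr_fst_std_bivariate_normal assms)
qed

section \<open>Regression under a gaussian copula\<close>

lemma prob_space_std_normal: "prob_space std_normal_distribution"
  by (rule prob_space_normal_density) simp

lemma (in sigma_finite_measure) distr_pair_snd_prob_space:
  assumes "prob_space N"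
  shows "distr (N \<Otimes>\<^sub>M M) M snd = M"
proof (rule measure_eqI)
  interpret N: prob_space N by fact
  fix A assume "A \<in> sets (distr (N \<Otimes>\<^sub>M M) M snd)"
  then have A: "A \<in> sets M" by simp
  then have "snd -` A \<inter> space (N \<Otimes>\<^sub>M M) = space N \<times> A"
    by (auto simp: space_pair_measure dest: sets.sets_into_space)
  then show "emeasure (distr (N \<Otimes>\<^sub>M M) M snd) A = emeasure M A"
    using A by (simp add: emeasure_distr emeasure_pair_measure_Times N.emeasure_space_1)
qed simp

text \<open>The residual of the regression of \<open>Z\<close> on \<open>X\<close> is made explicit as an independent standard normal
variable. Equality of copulas and of margins identifies the law of \<open>(X / s, Z / \<sigma>)\<close> with the standard
bivariate normal one, and there removing the correlation leaves a product measure.\<close>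
lemma (in prob_space) gaussian_copula_regression:
  assumes \<rho>: "-1 < \<rho>" "\<rho> < 1" and pos: "s > 0" "\<sigma> > 0"
    and C: "is_gaussian_copula \<rho> C" "is_copula_of C M X Z"
    and X: "distributed M lborel X (normal_density 0 s)"
    and Z: "distributed M lborel Z (normal_density 0 \<sigma>)"
  obtains W where "indep_var borel X borel W" "distributed M lborel W std_normal_density"
    "\<And>w. Z w = \<rho> * \<sigma> / s * X w + \<sigma> * sqrt (1 - \<rho>\<^sup>2) * W w"
proof
  let ?B = "std_bivariate_normal \<rho>" and ?N = "std_normal_distribution"
  define c where "c = sqrt (1 - \<rho>\<^sup>2)"
  have "\<rho>\<^sup>2 < 1" using \<rho> by (simp add: abs_square_less_1)
  then have c: "c > 0" by (simp add: c_def)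
  define W where "W = (\<lambda>w. (Z w / \<sigma> - \<rho> * (X w / s)) / c)"
  have [measurable]: "X \<in> borel_measurable M" "Z \<in> borel_measurable M"
    using X Z by (auto dest: distributed_measurable)
  have [measurable]: "W \<in> borel_measurable M" by (simp add: W_def)
  interpret B: prob_space ?B by (rule prob_space_std_bivariate_normal[OF \<rho>])
  interpret N: prob_space ?N by (rule prob_space_std_normal)
  have [measurable_cong]: "sets ?B = sets (borel \<Otimes>\<^sub>M borel)"
    by (simp only: std_bivariate_normal_def sets_density sets_lborel borel_prod)
  have scaled_margin: "distr M borel (\<lambda>w. V w / r) = ?N"
    if "r > 0" "distributed M lborel V (normal_density 0 r)" for V r
    using normal_standard_normal_convert[of r V 0] that
    by (auto simp: distributed_def cong: distr_cong)
  have law: "distr M borel (\<lambda>w. (1 / s * X w, 1 / \<sigma> * Z w)) = distr ?B borel (\<lambda>p. (fst p, snd p))"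
  proof (rule distr_pair_eq_if_same_copula)
    show "is_copula_of C M (\<lambda>w. 1 / s * X w) (\<lambda>w. 1 / \<sigma> * Z w)"
      using pos by (intro is_copula_of_scale C) auto
    show "is_copula_of C ?B fst snd" using C(1) by (simp add: is_gaussian_copula_def)
  qed (use \<rho> scaled_margin[OF pos(1) X] scaled_margin[OF pos(2) Z] in
      \<open>auto simp: distr_fst_std_bivariate_normal distr_snd_std_bivariate_normal
        prob_space_axioms B.prob_space_axioms\<close>)
  have "distr M (borel \<Otimes>\<^sub>M borel) (\<lambda>w. (X w / s, W w))
      = distr (distr M borel (\<lambda>w. (1 / s * X w, 1 / \<sigma> * Z w))) (borel \<Otimes>\<^sub>M borel)
          (\<lambda>p. (fst p, (snd p - \<rho> * fst p) / c))"
    unfolding borel_prod[symmetric] by (subst distr_distr) (auto simp: comp_def W_def)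
  also have "\<dots> = distr ?B (borel \<Otimes>\<^sub>M borel) (\<lambda>p. (fst p, (snd p - \<rho> * fst p) / c))"
    unfolding law unfolding borel_prod[symmetric] by (subst distr_distr) (auto simp: comp_def)
  also have "\<dots> = distr (?N \<Otimes>\<^sub>M ?N) (borel \<Otimes>\<^sub>M borel) (\<lambda>p. p)"
    unfolding std_bivariate_normal_eq_distr[OF \<rho>] c_def[symmetric] borel_prod[symmetric]
    using c by (subst distr_distr) (auto simp: comp_def case_prod_beta)
  also have "\<dots> = ?N \<Otimes>\<^sub>M ?N"
    by (rule distr_id2) simp
  finally have joint: "distr M (borel \<Otimes>\<^sub>M borel) (\<lambda>w. (X w / s, W w)) = ?N \<Otimes>\<^sub>M ?N" .
  have "distr M borel W = distr (distr M (borel \<Otimes>\<^sub>M borel) (\<lambda>w. (X w / s, W w))) borel snd"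
    by (subst distr_distr) (auto simp: comp_def)
  also have "\<dots> = distr (?N \<Otimes>\<^sub>M ?N) ?N snd"
    unfolding joint by (rule distr_cong) auto
  also have "\<dots> = ?N"
    by (rule N.distr_pair_snd_prob_space[OF prob_space_std_normal])
  finally have W: "distr M borel W = ?N" .
  then show "distributed M lborel W std_normal_density"
    by (auto simp: distributed_def cong: distr_cong)
  have "indep_var borel (\<lambda>w. X w / s) borel W"
    unfolding indep_var_distribution_eq using joint W scaled_margin[OF pos(1) X] by simp
  then have "indep_var borel ((\<lambda>x. s * x) \<circ> (\<lambda>w. X w / s)) borel (id \<circ> W)"
    by (rule indep_var_compose) auto
  then show "indep_var borel X borel W"
    using pos by (simp add: comp_def)
  show "Z w = \<rho> * \<sigma> / s * X w + \<sigma> * sqrt (1 - \<rho>\<^sup>2) * W w" for w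
  proof -
    have "c * W w = Z w / \<sigma> - \<rho> * (X w / s)"
      using c by (simp add: W_def)
    then have "\<sigma> * (c * W w) = \<sigma> * (Z w / \<sigma>) - \<sigma> * (\<rho> * (X w / s))"
      by (simp only: right_diff_distrib)
    then show ?thesis using pos unfolding c_def by (simp add: mult_ac)
  qed
qed

lemma (in prob_space) normal_distributed_integrable:
  assumes "0 < s" and D: "distributed M lborel X (normal_density 0 s)"
  shows "integrable M X" "integrable M (\<lambda>w. (X w)\<^sup>2)"
proof -
  have "integrable lborel (\<lambda>x. normal_density 0 s x * x ^ k)" for k
    using integrable_normal_moment[OF assms(1), of 0 k] by simp
  from this[of 1] this[of 2] show "integrable M X" "integrable M (\<lambda>w. (X w)\<^sup>2)"
    using distributed_integrable[OF D, of "\<lambda>x. x"] distributed_integrable[OF D, of "\<lambda>x. x\<^sup>2"]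
    by auto
qed

text \<open>By the regression, \<open>X + Z\<close> is a sum of independent normal variables,
\<open>(1 + \<rho> \<sigma> / s) X + \<sigma> sqrt (1 - \<rho>\<^sup>2) W\<close>, whose variances add up to
\<open>(s + \<rho> \<sigma>)\<^sup>2 + \<sigma>\<^sup>2 (1 - \<rho>\<^sup>2)\<close>.\<close>
lemma (in prob_space) gaussian_copula_sum_normal:
  assumes \<rho>: "-1 < \<rho>" "\<rho> < 1" and pos: "s > 0" "\<sigma> > 0"
    and C: "is_gaussian_copula \<rho> C" "is_copula_of C M X Z"
    and X: "distributed M lborel X (normal_density 0 s)"
    and Z: "distributed M lborel Z (normal_density 0 \<sigma>)"
  shows "distributed M lborel (\<lambda>w. X w + Z w)
    (normal_density 0 (sqrt (s\<^sup>2 + 2 * \<rho> * \<sigma> * s + \<sigma>\<^sup>2)))"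
proof -
  obtain W where indep: "indep_var borel X borel W" and W: "distributed M lborel W std_normal_density"
    and Z_eq: "\<And>w. Z w = \<rho> * \<sigma> / s * X w + \<sigma> * sqrt (1 - \<rho>\<^sup>2) * W w"
    using gaussian_copula_regression[OF assms] by blast
  have "\<rho>\<^sup>2 < 1" using \<rho> by (simp add: abs_square_less_1)
  let ?a = "1 + \<rho> * \<sigma> / s" and ?b = "\<sigma> * sqrt (1 - \<rho>\<^sup>2)"
  have b: "?b > 0" using pos \<open>\<rho>\<^sup>2 < 1\<close> by simp
  have bW: "distributed M lborel (\<lambda>w. ?b * W w) (normal_density 0 ?b)"
  proof -
    have "distributed M lborel (\<lambda>w. 0 + ?b * W w) (normal_density (0 + ?b * 0) (\<bar>?b\<bar> * 1))"
      by (rule normal_density_affine[OF W]) (use b in auto)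
    then show ?thesis using b by (simp only: abs_of_pos mult_zero_right mult_1_right add_0_left)
  qed
  have var: "s\<^sup>2 + 2 * \<rho> * \<sigma> * s + \<sigma>\<^sup>2 = (?a * s)\<^sup>2 + ?b\<^sup>2"
  proof -
    have "?b\<^sup>2 = \<sigma>\<^sup>2 * (1 - \<rho>\<^sup>2)" "?a * s = s + \<rho> * \<sigma>"
      using \<open>\<rho>\<^sup>2 < 1\<close> pos by (auto simp: power_mult_distrib field_simps)
    then show ?thesis by (simp only:) (simp add: power2_eq_square algebra_simps)
  qed
  have sum_eq: "X w + Z w = ?a * X w + ?b * W w" for w
    by (simp add: Z_eq algebra_simps)
  show ?thesis
  \<comment> \<open>The coefficient of \<open>X\<close> vanishes when \<open>s = - \<rho> \<sigma>\<close>; a constant is not normal in the sense of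
    having a density, so the closure of normal laws under independent sums does not cover this case.\<close>
  proof (cases "?a = 0")
    case True
    then show ?thesis using bW b unfolding sum_eq var by simp
  next
    case False
    have aX: "distributed M lborel (\<lambda>w. ?a * X w) (normal_density 0 (\<bar>?a\<bar> * s))"
      using normal_density_affine[OF X pos(1) False, of 0] by simp
    have "indep_var borel ((\<lambda>x. ?a * x) \<circ> X) borel ((\<lambda>x. ?b * x) \<circ> W)"
      by (rule indep_var_compose[OF indep]) auto
    then have "indep_var borel (\<lambda>w. ?a * X w) borel (\<lambda>w. ?b * W w)"
      by (simp add: comp_def)
    from add_indep_normal[OF this _ b aX bW] show ?thesis
      using pos False unfolding sum_eq var by (simp add: power_mult_distrib)
  qed
qed

section \<open>Conditional expectations along a Markov process\<close>

lemma space_generated_algebra: "space (generated_algebra M Y I) = space M"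
  by (simp add: generated_algebra_def space_measure_of_conv)

lemma sets_generated_algebra:
  "sets (generated_algebra M Y I)
    = sigma_sets (space M) (\<Union>i\<in>I. {Y i -` B \<inter> space M | B. B \<in> sets borel})"
  unfolding generated_algebra_def by (rule sets_measure_of) blast

lemma sets_generated_algebra_singleton:
  "sets (generated_algebra M Y {t}) = {Y t -` B \<inter> space M | B. B \<in> sets borel}"
  using sets_vimage_algebra2[of "Y t" "space M" "borel :: real measure"]
  by (simp add: sets_generated_algebra sets_vimage_algebra)

lemma subalgebra_generated_algebra:
  assumes "\<And>i. i \<in> I \<Longrightarrow> Y i \<in> borel_measurable M"
  shows "subalgebra M (generated_algebra M Y I)"
  unfolding subalgebra_def space_generated_algebra sets_generated_algebra
proof (intro conjI refl sets.sigma_sets_subset UN_least subsetI)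
  fix i A assume "i \<in> I" "A \<in> {Y i -` B \<inter> space M | B. B \<in> sets borel}"
  then show "A \<in> sets M" using assms by (blast intro: measurable_sets)
qed

lemma measurable_generated_algebra:
  assumes "i \<in> I"
  shows "Y i \<in> borel_measurable (generated_algebra M Y I)"
proof (rule measurableI)
  fix B :: "real set" assume "B \<in> sets borel"
  then show "Y i -` B \<inter> space (generated_algebra M Y I) \<in> sets (generated_algebra M Y I)"
    unfolding space_generated_algebra sets_generated_algebra
    using assms by (blast intro: sigma_sets.Basic)
qed simp

text \<open>In the regression of \<open>Z\<close> on \<open>Y t\<close> the residual is independent of \<open>Y t\<close> and has mean zero, so it
integrates to zero over every event determined by \<open>Y t\<close>.\<close>
lemma (in prob_space) gaussian_copula_cond_exp:
  assumes \<rho>: "-1 < \<rho>" "\<rho> < 1" and pos: "s > 0" "\<sigma> > 0"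
    and C: "is_gaussian_copula \<rho> C" "is_copula_of C M (Y t) Z"
    and X: "distributed M lborel (Y t) (normal_density 0 s)"
    and Z: "distributed M lborel Z (normal_density 0 \<sigma>)"
  shows "AE w in M. real_cond_exp M (generated_algebra M Y {t}) Z w = \<rho> * \<sigma> / s * Y t w"
proof -
  obtain W where indep: "indep_var borel (Y t) borel W"
    and W: "distributed M lborel W std_normal_density"
    and Z_eq: "\<And>w. Z w = \<rho> * \<sigma> / s * Y t w + \<sigma> * sqrt (1 - \<rho>\<^sup>2) * W w"
    using gaussian_copula_regression[OF assms] by blast
  have [measurable]: "Y t \<in> borel_measurable M" using X by (auto dest: distributed_measurable)
  interpret G: finite_measure_subalgebra M "generated_algebra M Y {t}"
    by unfold_locales (rule subalgebra_generated_algebra, simp)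
  have int: "integrable M (Y t)" "integrable M Z" "integrable M W"
    using normal_distributed_integrable(1)[OF pos(1) X] normal_distributed_integrable(1)[OF pos(2) Z]
      normal_distributed_integrable(1)[OF zero_less_one W] by simp_all
  show ?thesis
  proof (rule G.real_cond_exp_charact)
    fix A assume "A \<in> sets (generated_algebra M Y {t})"
    then obtain B where B[measurable]: "B \<in> sets borel" and A: "A = Y t -` B \<inter> space M"
      unfolding sets_generated_algebra_singleton by blast
    have A_M[measurable]: "A \<in> sets M" unfolding A by simp
    have "indep_var borel (indicator B \<circ> Y t) borel (id \<circ> W)"
      by (rule indep_var_compose[OF indep]) auto
    then have "indep_var borel (\<lambda>w. indicator B (Y t w) :: real) borel W" by (simp add: comp_def)
    from indep_var_lebesgue_integral[OF this _ int(3)]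
    have "(\<integral>w. indicator B (Y t w) * W w \<partial>M) = 0"
      using standard_normal_distributed_expectation[OF W]
      by (simp add: integrable_const_bound[where B = 1])
    then have "(\<integral>w\<in>A. W w \<partial>M) = 0"
      unfolding set_lebesgue_integral_def
      by (subst Bochner_Integration.integral_cong[OF refl, where g = "\<lambda>w. indicator B (Y t w) * W w"])
         (auto simp: A indicator_def)
    moreover have "set_integrable M A (Y t)" "set_integrable M A W"
      using int by (simp_all only: set_integrable_def integrable_mult_indicator[OF A_M])
    ultimately show "(\<integral>w\<in>A. Z w \<partial>M) = (\<integral>w\<in>A. \<rho> * \<sigma> / s * Y t w \<partial>M)"
      unfolding Z_eq
      by (simp only: set_integral_add set_integrable_mult_right set_integral_mult_right
          mult_zero_right add_0_right)
  next
    show "(\<lambda>w. \<rho> * \<sigma> / s * Y t w) \<in> borel_measurable (generated_algebra M Y {t})"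
      by (intro borel_measurable_times borel_measurable_const measurable_generated_algebra) simp
  qed (use int in auto)
qed

text \<open>Passage from conditional probabilities of events \<open>V \<in> B\<close> to the conditional expectation of \<open>V\<close>
itself, without approximation by simple functions. For \<open>A\<close> in \<open>F\<close>, let \<open>h\<close> be the conditional
probability of \<open>A\<close> given \<open>G\<close>. Moving conditional expectations from one factor to the other, the
hypothesis says that \<open>A\<close> and \<open>h\<close> have the same integral over each event \<open>V \<in> B\<close>. Thus
\<open>indicator A - h\<close> has conditional expectation zero given \<open>V\<close>, hence is orthogonal to \<open>V\<close>; and
the integral of \<open>h * V\<close> is that of the conditional expectation of \<open>V\<close> given \<open>G\<close> over \<open>A\<close>.\<close>
lemma (in prob_space) cond_exp_eq_if_indicators:
  fixes V :: "'a \<Rightarrow> real"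
  assumes F: "subalgebra M F" and G: "subalgebra F G" and V: "integrable M V"
    and eq: "\<And>B. B \<in> sets borel \<Longrightarrow> AE w in M.
      real_cond_exp M F (indicator (V -` B \<inter> space M)) w
      = real_cond_exp M G (indicator (V -` B \<inter> space M)) w"
  shows "AE w in M. real_cond_exp M F V w = real_cond_exp M G V w"
proof -
  define H where "H = vimage_algebra (space M) V borel"
  have [measurable]: "V \<in> borel_measurable M" using V by auto
  have MG: "subalgebra M G" using F G by (auto simp: subalgebra_def)
  have H: "subalgebra M H"
    unfolding subalgebra_def H_def by (auto simp: sets_vimage_algebra2)
  have VH: "V \<in> borel_measurable H" unfolding H_def by (rule measurable_vimage_algebra1) simp
  interpret F: finite_measure_subalgebra M F by unfold_locales fact
  interpret G: finite_measure_subalgebra M G by unfold_locales fact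
  interpret H: finite_measure_subalgebra M H by unfold_locales fact
  have int_ind: "integrable M (indicator A :: 'a \<Rightarrow> real)" if "A \<in> sets M" for A
    using that by (intro integrable_real_indicator) (auto simp: emeasure_eq_measure)
  show ?thesis
  proof (rule F.real_cond_exp_charact)
    fix A assume AF: "A \<in> sets F"
    then have A[measurable]: "A \<in> sets M" using F by (auto simp: subalgebra_def)
    define h where "h = real_cond_exp M G (indicator A)"
    have h_int: "integrable M h" unfolding h_def by (rule G.real_cond_exp_int) (rule int_ind[OF A])
    have hG: "h \<in> borel_measurable G" by (simp add: h_def)
    have [measurable]: "h \<in> borel_measurable M" using h_int by auto
    have "AE w in M. h w \<ge> 0" "AE w in M. h w \<le> 1"
      unfolding h_def using int_ind[OF A]
      by (auto intro!: G.real_cond_exp_ge_c G.real_cond_exp_le_c simp: indicator_def)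
    then have h_bound: "AE w in M. norm (h w * V w) \<le> norm (V w)"
      by eventually_elim (simp add: abs_mult mult_left_le_one_le)
    have hV: "integrable M (\<lambda>w. h w * V w)"
      by (rule Bochner_Integration.integrable_bound[OF V _ h_bound]) simp
    have AV: "integrable M (\<lambda>w. indicator A w * V w)"
      using integrable_mult_indicator[OF A V] by simp
    have orth: "AE w in M. real_cond_exp M H (\<lambda>w. indicator A w - h w) w = 0"
    proof (rule H.real_cond_exp_charact)
      fix S assume "S \<in> sets H"
      then obtain B where B: "B \<in> sets borel" and S_eq: "S = V -` B \<inter> space M"
        by (auto simp: H_def sets_vimage_algebra2)
      have S[measurable]: "S \<in> sets M" unfolding S_eq using B by simp
      define g where "g = real_cond_exp M G (indicator S)"
      have g_int: "integrable M g" unfolding g_def by (rule G.real_cond_exp_int) (rule int_ind[OF S])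
      have gG: "g \<in> borel_measurable G" by (simp add: g_def)
      have [measurable]: "g \<in> borel_measurable M" using g_int by auto
      have AS_int: "integrable M (\<lambda>w. indicator A w * indicator S w :: real)"
        using integrable_mult_indicator[OF A int_ind[OF S]] by simp
      have hS_int: "integrable M (\<lambda>w. h w * indicator S w)"
        using integrable_mult_indicator[OF S h_int] by (simp add: mult.commute)
      have gA_int: "integrable M (\<lambda>w. g w * indicator A w)"
        using integrable_mult_indicator[OF A g_int] by (simp add: mult.commute)
      have "(\<integral>w. indicator A w * indicator S w \<partial>M)
          = (\<integral>w. indicator A w * real_cond_exp M F (indicator S) w \<partial>M)"
        by (rule F.real_cond_exp_intg(2)[symmetric]) (use AS_int AF in auto)
      also have "\<dots> = (\<integral>w. g w * indicator A w \<partial>M)"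
      proof (rule integral_cong_AE)
        show "AE w in M. indicator A w * real_cond_exp M F (indicator S) w = g w * indicator A w"
          using eq[OF B] unfolding g_def S_eq by eventually_elim simp
      qed auto
      also have "\<dots> = (\<integral>w. g w * h w \<partial>M)"
        unfolding h_def by (rule G.real_cond_exp_intg(2)[symmetric]) (use gA_int gG in auto)
      also have "\<dots> = (\<integral>w. h w * indicator S w \<partial>M)"
        unfolding mult.commute[of "g _"] unfolding g_def
        by (rule G.real_cond_exp_intg(2)) (use hS_int hG in auto)
      finally have "(\<integral>w. indicator A w * indicator S w \<partial>M) = (\<integral>w. h w * indicator S w \<partial>M)" .
      then have "(\<integral>w. indicator A w * indicator S w - h w * indicator S w \<partial>M) = 0"
        using AS_int hS_int by simp
      then show "(\<integral>w\<in>S. indicator A w - h w \<partial>M) = (\<integral>w\<in>S. 0 \<partial>M)"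
        by (simp add: set_lebesgue_integral_def algebra_simps)
    qed (use h_int int_ind[OF A] in auto)
    have VU: "integrable M (\<lambda>w. V w * (indicator A w - h w))"
      using Bochner_Integration.integrable_diff[OF AV hV] by (simp add: algebra_simps)
    have "(\<integral>w. indicator A w * V w \<partial>M) - (\<integral>w. h w * V w \<partial>M) = (\<integral>w. V w * (indicator A w - h w) \<partial>M)"
      using AV hV by (subst Bochner_Integration.integral_diff[symmetric]) (auto simp: algebra_simps)
    also have "\<dots> = (\<integral>w. V w * real_cond_exp M H (\<lambda>w. indicator A w - h w) w \<partial>M)"
      by (rule H.real_cond_exp_intg(2)[symmetric]) (use VU VH in auto)
    also have "\<dots> = 0"
      by (rule integral_eq_zero_AE) (use orth in eventually_elim, simp)
    finally have "(\<integral>w. indicator A w * V w \<partial>M) = (\<integral>w. h w * V w \<partial>M)" by simp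
    also have "\<dots> = (\<integral>w. h w * real_cond_exp M G V w \<partial>M)"
      by (rule G.real_cond_exp_intg(2)[symmetric]) (use hV hG in auto)
    also have "\<dots> = (\<integral>w. real_cond_exp M G V w * h w \<partial>M)"
      by (simp add: mult.commute)
    also have "\<dots> = (\<integral>w. real_cond_exp M G V w * indicator A w \<partial>M)"
      unfolding h_def
    proof (rule G.real_cond_exp_intg(2))
      show "integrable M (\<lambda>w. real_cond_exp M G V w * indicat_real A w)"
        using integrable_mult_indicator[OF A G.real_cond_exp_int(1)[OF V]] by (simp add: mult.commute)
    qed auto
    finally show "(\<integral>w\<in>A. V w \<partial>M) = (\<integral>w\<in>A. real_cond_exp M G V w \<partial>M)"
      by (simp add: set_lebesgue_integral_def mult.commute)
  next
    show "real_cond_exp M G V \<in> borel_measurable F"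
      by (rule measurable_from_subalg[OF G]) simp
  qed (use V G.real_cond_exp_int in auto)
qed

lemma (in prob_space) markov_process_cond_exp:
  assumes "markov_process M Y" and "integrable M (Y (Suc n))"
  shows "AE w in M. real_cond_exp M (generated_algebra M Y {..n}) (Y (Suc n)) w
    = real_cond_exp M (generated_algebra M Y {n}) (Y (Suc n)) w"
proof (rule cond_exp_eq_if_indicators)
  have [measurable]: "Y i \<in> borel_measurable M" for i
    using assms(1) by (simp add: markov_process_def)
  show "subalgebra M (generated_algebra M Y {..n})"
    by (rule subalgebra_generated_algebra) simp
  show "subalgebra (generated_algebra M Y {..n}) (generated_algebra M Y {n})"
    unfolding subalgebra_def space_generated_algebra sets_generated_algebra
    by (auto intro!: sigma_sets_mono')
qed (use assms in \<open>auto simp: markov_process_def\<close>)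

section \<open>The marginal standard deviations\<close>

text \<open>The value \<open>0\<close> at time \<open>0\<close> belongs to the deterministic start of the process; the recursion then
gives \<open>\<sigma>\<close> at time \<open>1\<close>.\<close>
primrec marginal_sd :: "real \<Rightarrow> real \<Rightarrow> nat \<Rightarrow> real" where
  "marginal_sd \<rho> \<sigma> 0 = 0"
| "marginal_sd \<rho> \<sigma> (Suc n) = sqrt ((marginal_sd \<rho> \<sigma> n)\<^sup>2 + 2 * \<rho> * \<sigma> * marginal_sd \<rho> \<sigma> n + \<sigma>\<^sup>2)"

text \<open>The difference of the two sides is \<open>(1 - \<rho>\<^sup>2) \<sigma>\<^sup>2\<close>, the part of the variance due to the
residual. The bound serves both for positivity of the standard deviations and for the contraction estimate.\<close>
lemma marginal_variance_bound:
  fixes \<rho> \<sigma> s :: real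
  assumes "-1 < \<rho>" "\<rho> < 1" "\<sigma> > 0"
  shows "(s + \<rho> * \<sigma>)\<^sup>2 < s\<^sup>2 + 2 * \<rho> * \<sigma> * s + \<sigma>\<^sup>2"
proof -
  have "\<rho>\<^sup>2 < 1" using assms by (simp add: abs_square_less_1)
  then have "\<rho>\<^sup>2 * \<sigma>\<^sup>2 < \<sigma>\<^sup>2" using assms by simp
  then show ?thesis by (simp add: power2_eq_square algebra_simps)
qed

lemma marginal_sd_pos:
  assumes "-1 < \<rho>" "\<rho> < 1" "\<sigma> > 0" "n \<ge> 1"
  shows "marginal_sd \<rho> \<sigma> n > 0"
proof -
  obtain m where n: "n = Suc m" using assms(4) by (cases n) auto
  show ?thesis
    using marginal_variance_bound[OF assms(1-3), of "marginal_sd \<rho> \<sigma> m"]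
      zero_le_power2[of "marginal_sd \<rho> \<sigma> m + \<rho> * \<sigma>"]
    unfolding n marginal_sd.simps real_sqrt_gt_0_iff by linarith
qed

text \<open>Write \<open>L\<close> for the limit and \<open>s'\<close> for the successor of \<open>s\<close>. Since \<open>L\<close> is a fixed point,
\<open>(s' - L) (s' + L) = (s - L) (s + L + 2 \<rho> \<sigma>)\<close>, so the distance to \<open>L\<close> shrinks by the factor
\<open>\<bar>s + L + 2 \<rho> \<sigma>\<bar> / (s' + L)\<close>. Because \<open>\<bar>s + \<rho> \<sigma>\<bar> \<le> s'\<close>, its numerator stays below its
denominator by a fixed amount \<open>\<delta>\<close>. In particular the distance to \<open>L\<close> never grows, the sequence
started at \<open>0\<close> never exceeds \<open>2 L\<close>, and the factor is at most \<open>1 - \<delta> / (3 L)\<close>.\<close>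
lemma marginal_sd_tendsto:
  assumes \<rho>: "-1 < \<rho>" "\<rho> < 0" and \<sigma>: "\<sigma> > 0"
  shows "marginal_sd \<rho> \<sigma> \<longlonglongrightarrow> - \<sigma> / (2 * \<rho>)"
proof -
  define L where "L = - \<sigma> / (2 * \<rho>)"
  define \<delta> where "\<delta> = min (- \<rho> * \<sigma>) (2 * L + \<rho> * \<sigma>)"
  define q where "q = 1 - \<delta> / (3 * L)"
  have L: "L > 0" using \<rho> \<sigma> by (simp add: L_def field_simps)
  have fix_L: "2 * \<rho> * L = - \<sigma>" using \<rho> by (simp add: L_def)
  have "\<rho>\<^sup>2 < 1" using \<rho> by (simp add: abs_square_less_1)
  have "2 * L + \<rho> * \<sigma> = \<sigma> * (1 - \<rho>\<^sup>2) / (- \<rho>)"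
    using \<rho> by (simp add: L_def field_simps power2_eq_square)
  also have "\<dots> > 0" using \<rho> \<sigma> \<open>\<rho>\<^sup>2 < 1\<close> by (intro divide_pos_pos mult_pos_pos) auto
  finally have lower: "2 * L + \<rho> * \<sigma> > 0" .
  then have \<delta>: "\<delta> > 0" using \<rho> \<sigma> by (simp add: \<delta>_def mult_neg_pos)
  have "\<delta> \<le> 2 * L + \<rho> * \<sigma>" by (simp add: \<delta>_def)
  also have "\<dots> \<le> 3 * L" using L \<rho> \<sigma> mult_neg_pos[OF \<rho>(2) \<sigma>] by linarith
  finally have q: "0 \<le> q" "q < 1" using L \<delta> by (auto simp: q_def field_simps)
  have geometric: "\<bar>marginal_sd \<rho> \<sigma> n - L\<bar> \<le> q ^ n * L" for n
  proof (induction n)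
    case 0
    then show ?case using L by simp
  next
    case (Suc n)
    define s where "s = marginal_sd \<rho> \<sigma> n"
    define s' where "s' = marginal_sd \<rho> \<sigma> (Suc n)"
    have var: "(s + \<rho> * \<sigma>)\<^sup>2 < s\<^sup>2 + 2 * \<rho> * \<sigma> * s + \<sigma>\<^sup>2"
      using \<rho> \<sigma> by (intro marginal_variance_bound) auto
    then have s'2: "s'\<^sup>2 = s\<^sup>2 + 2 * \<rho> * \<sigma> * s + \<sigma>\<^sup>2"
      using zero_le_power2[of "s + \<rho> * \<sigma>"]
      unfolding s'_def marginal_sd.simps s_def[symmetric] by (intro real_sqrt_pow2) linarith
    have s'_pos: "s' > 0" unfolding s'_def by (rule marginal_sd_pos) (use \<rho> \<sigma> in auto)
    have "\<bar>s + \<rho> * \<sigma>\<bar> \<le> s'"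
    proof (rule power2_le_imp_le)
      show "\<bar>s + \<rho> * \<sigma>\<bar>\<^sup>2 \<le> s'\<^sup>2" using var unfolding s'2 by simp
    qed (use s'_pos in simp)
    \<comment> \<open>The two terms of \<open>\<delta>\<close> are the margins in the upper and in the lower bound on the left-hand side.\<close>
    have gap: "\<bar>s + L + 2 * \<rho> * \<sigma>\<bar> \<le> s' + L - \<delta>"
      using \<open>\<bar>s + \<rho> * \<sigma>\<bar> \<le> s'\<close> unfolding \<delta>_def by (auto simp: abs_le_iff min_def)
    have "(s' - L) * (s' + L) = (s - L) * (s + L + 2 * \<rho> * \<sigma>)"
    proof -
      have "s'\<^sup>2 - L\<^sup>2 = (s - L) * (s + L) + 2 * \<rho> * \<sigma> * s + \<sigma>\<^sup>2"
        unfolding s'2 by (simp add: power2_eq_square algebra_simps)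
      also have "\<sigma>\<^sup>2 = - (2 * \<rho> * L) * \<sigma>" unfolding fix_L by (simp add: power2_eq_square)
      finally show ?thesis by (simp add: power2_eq_square algebra_simps)
    qed
    then have "\<bar>s' - L\<bar> * (s' + L) = \<bar>s - L\<bar> * \<bar>s + L + 2 * \<rho> * \<sigma>\<bar>"
      using s'_pos L by (metis abs_mult abs_of_pos add_pos_pos)
    also have "\<dots> \<le> \<bar>s - L\<bar> * (s' + L - \<delta>)"
      using gap by (intro mult_left_mono) auto
    finally have contr: "\<bar>s' - L\<bar> * (s' + L) \<le> \<bar>s - L\<bar> * (s' + L - \<delta>)" .
    also have "\<dots> \<le> \<bar>s - L\<bar> * (s' + L)" using \<delta> by (intro mult_left_mono) auto
    finally have "\<bar>s' - L\<bar> \<le> \<bar>s - L\<bar>" using s'_pos L by simp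
    moreover have IH: "\<bar>s - L\<bar> \<le> q ^ n * L" using Suc.IH by (simp add: s_def)
    moreover have "q ^ n * L \<le> L" using q L by (simp add: power_le_one)
    ultimately have "s' + L \<le> 3 * L" by linarith
    then have "\<delta> * (s' + L) \<le> \<delta> * (3 * L)" using \<delta> by simp
    then have "s' + L - \<delta> \<le> q * (s' + L)"
      using L by (simp add: q_def field_simps)
    then have "\<bar>s - L\<bar> * (s' + L - \<delta>) \<le> \<bar>s - L\<bar> * (q * (s' + L))"
      by (intro mult_left_mono) auto
    with contr have "\<bar>s' - L\<bar> * (s' + L) \<le> (q * \<bar>s - L\<bar>) * (s' + L)"
      by (simp add: mult_ac)
    then have "\<bar>s' - L\<bar> \<le> q * \<bar>s - L\<bar>" using s'_pos L by simp
    also have "\<dots> \<le> q * (q ^ n * L)" using IH q by (intro mult_left_mono) auto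
    finally show ?case by (simp add: s'_def mult.assoc)
  qed
  have "(\<lambda>n. q ^ n * L) \<longlonglongrightarrow> 0"
    using q LIMSEQ_power_zero[of q] tendsto_mult_left_zero by force
  then have "(\<lambda>n. marginal_sd \<rho> \<sigma> n - L) \<longlonglongrightarrow> 0"
    by (rule Lim_null_comparison[rotated]) (use geometric in auto)
  then show ?thesis unfolding L_def[symmetric] by (simp add: LIM_zero_iff)
qed

section \<open>Moments and autocorrelation of the process\<close>

lemma (in gaussian_convolution_process) Y_measurable [measurable]: "Y i \<in> borel_measurable M"
  using markov by (simp add: markov_process_def)

lemma (in gaussian_convolution_process) gaussian_copula_step:
  assumes "n \<ge> 1"
  obtains C where "is_gaussian_copula \<rho> C" "is_copula_of C M (Y n) (\<xi> (Suc n))"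
proof -
  obtain C where C: "is_gaussian_copula \<rho> C" "\<And>t. t \<ge> 2 \<Longrightarrow> is_copula_of C M (Y (t - 1)) (\<xi> t)"
    using dependence by blast
  show thesis by (rule that[OF C(1)]) (use C(2)[of "Suc n"] assms in simp)
qed

lemma (in gaussian_convolution_process) marginal_normal:
  assumes \<rho>: "-1 < \<rho>" "\<rho> < 1" and \<sigma>: "\<sigma>\<^sub>\<xi> > 0" and "n \<ge> 1"
  shows "distributed M lborel (Y n) (normal_density 0 (marginal_sd \<rho> \<sigma>\<^sub>\<xi> n))"
  using \<open>n \<ge> 1\<close>
proof (induction n rule: nat_induct_at_least)
  \<comment> \<open>The equations of the process hold only on the sample space, whereas random variables are total
    functions.\<close>
  have distributed_cong: "distributed M lborel V f" if "distributed M lborel U f"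
    "\<And>w. w \<in> space M \<Longrightarrow> V w = U w" for U V :: "'a \<Rightarrow> real" and f
    using that unfolding distributed_def
    by (auto cong: distr_cong measurable_cong)
  {
    case base
    have "Y 1 w = \<xi> 1 w" if "w \<in> space M" for w
      using step[of 1 w] start that by simp
    from distributed_cong[OF innovation[OF order_refl] this] show ?case using \<sigma> by simp
  next
    case (Suc n)
    obtain C where C: "is_gaussian_copula \<rho> C" "is_copula_of C M (Y n) (\<xi> (Suc n))"
      using gaussian_copula_step[OF Suc.hyps] .
    from gaussian_copula_sum_normal[OF \<rho> marginal_sd_pos[OF \<rho> \<sigma> Suc.hyps] \<sigma> C Suc.IH innovation]
    have "distributed M lborel (\<lambda>w. Y n w + \<xi> (Suc n) w) (normal_density 0 (marginal_sd \<rho> \<sigma>\<^sub>\<xi> (Suc n)))"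
      by simp
    moreover have "Y (Suc n) w = Y n w + \<xi> (Suc n) w" if "w \<in> space M" for w
      using step[of "Suc n" w] that by simp
    ultimately show ?case by (rule distributed_cong)
  }
qed

lemma (in gaussian_convolution_process) product_integrable:
  assumes "-1 < \<rho>" "\<rho> < 1" "\<sigma>\<^sub>\<xi> > 0" "m \<ge> 1" "n \<ge> 1"
  shows "integrable M (\<lambda>w. Y m w * Y n w)"
proof -
  have sq: "integrable M (\<lambda>w. (Y i w)\<^sup>2)" if "i \<ge> 1" for i
    using normal_distributed_integrable(2) marginal_sd_pos marginal_normal assms that by blast
  show ?thesis
  proof (rule Bochner_Integration.integrable_bound)
    show "integrable M (\<lambda>w. (Y m w)\<^sup>2 + (Y n w)\<^sup>2)" using sq assms by simp
    have "norm (a * b) \<le> norm (a\<^sup>2 + b\<^sup>2)" for a b :: real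
      using sum_squares_bound[of "\<bar>a\<bar>" "\<bar>b\<bar>"] mult_nonneg_nonneg[of "\<bar>a\<bar>" "\<bar>b\<bar>"]
      by (simp add: abs_mult del: mult_nonneg_nonneg)
    then show "AE w in M. norm (Y m w * Y n w) \<le> norm ((Y m w)\<^sup>2 + (Y n w)\<^sup>2)" by simp
  qed simp
qed

text \<open>The Markov property replaces the past by the present value, for which the regression of the
innovation is known.\<close>
lemma (in gaussian_convolution_process) cond_exp_given_past:
  assumes \<rho>: "-1 < \<rho>" "\<rho> < 1" and \<sigma>: "\<sigma>\<^sub>\<xi> > 0" and n: "n \<ge> 1"
  shows "AE w in M. real_cond_exp M (generated_algebra M Y {..n}) (Y (Suc n)) w
    = (1 + \<rho> * \<sigma>\<^sub>\<xi> / marginal_sd \<rho> \<sigma>\<^sub>\<xi> n) * Y n w"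
proof -
  have int: "integrable M (Y i)" if "i \<ge> 1" for i
    using normal_distributed_integrable(1) marginal_sd_pos marginal_normal \<rho> \<sigma> that by blast
  have int_\<xi>: "integrable M (\<xi> (Suc n))"
    using normal_distributed_integrable(1)[OF \<sigma> innovation] by simp
  interpret G: finite_measure_subalgebra M "generated_algebra M Y {n}"
    by unfold_locales (rule subalgebra_generated_algebra, simp)
  obtain C where C: "is_gaussian_copula \<rho> C" "is_copula_of C M (Y n) (\<xi> (Suc n))"
    using gaussian_copula_step[OF n] .
  from gaussian_copula_cond_exp[where Y = Y and t = n,
      OF \<rho> marginal_sd_pos[OF \<rho> \<sigma> n] \<sigma> C marginal_normal[OF \<rho> \<sigma> n] innovation]
  have "AE w in M. real_cond_exp M (generated_algebra M Y {n}) (\<xi> (Suc n)) w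
      = \<rho> * \<sigma>\<^sub>\<xi> / marginal_sd \<rho> \<sigma>\<^sub>\<xi> n * Y n w" by simp
  moreover have "AE w in M. real_cond_exp M (generated_algebra M Y {n}) (Y (Suc n)) w
      = real_cond_exp M (generated_algebra M Y {n}) (\<lambda>w. Y n w + \<xi> (Suc n) w) w"
    by (rule G.real_cond_exp_cong)
      (use step[of "Suc n"] int_\<xi> in \<open>auto intro!: AE_I2 borel_measurable_add\<close>)
  moreover have "AE w in M. real_cond_exp M (generated_algebra M Y {n}) (\<lambda>w. Y n w + \<xi> (Suc n) w) w
      = real_cond_exp M (generated_algebra M Y {n}) (Y n) w
        + real_cond_exp M (generated_algebra M Y {n}) (\<xi> (Suc n)) w"
    by (rule G.real_cond_exp_add[OF int[OF n] int_\<xi>])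
  moreover have "AE w in M. real_cond_exp M (generated_algebra M Y {n}) (Y n) w = Y n w"
    by (rule G.real_cond_exp_F_meas[OF int[OF n] measurable_generated_algebra]) simp
  moreover have "AE w in M. real_cond_exp M (generated_algebra M Y {..n}) (Y (Suc n)) w
    = real_cond_exp M (generated_algebra M Y {n}) (Y (Suc n)) w"
    by (rule markov_process_cond_exp[OF markov int]) simp
  ultimately show ?thesis by eventually_elim (simp add: algebra_simps)
qed

text \<open>Conditioning on the past up to time \<open>t + k\<close>, which contains \<open>Y t\<close>, splits off one factor for each
step.\<close>
lemma (in gaussian_convolution_process) covariance:
  assumes \<rho>: "-1 < \<rho>" "\<rho> < 1" and \<sigma>: "\<sigma>\<^sub>\<xi> > 0" and t: "t \<ge> 1"
  shows "expectation (\<lambda>w. Y t w * Y (t + k) w)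
    = (marginal_sd \<rho> \<sigma>\<^sub>\<xi> t)\<^sup>2 * (\<Prod>j<k. 1 + \<rho> * \<sigma>\<^sub>\<xi> / marginal_sd \<rho> \<sigma>\<^sub>\<xi> (t + j))"
proof (induction k)
  case 0
  have "expectation (Y t) = 0"
    using normal_distributed_expectation marginal_sd_pos marginal_normal assms by blast
  then show ?case
    using normal_distributed_variance[OF marginal_sd_pos[OF assms] marginal_normal[OF assms]]
    by (simp add: power2_eq_square)
next
  case (Suc k)
  let ?F = "generated_algebra M Y {..t + k}"
  let ?a = "1 + \<rho> * \<sigma>\<^sub>\<xi> / marginal_sd \<rho> \<sigma>\<^sub>\<xi> (t + k)"
  interpret F: finite_measure_subalgebra M ?F
    by unfold_locales (rule subalgebra_generated_algebra, simp)
  have "expectation (\<lambda>w. Y t w * Y (t + Suc k) w)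
      = expectation (\<lambda>w. Y t w * real_cond_exp M ?F (Y (t + Suc k)) w)"
    using product_integrable[OF \<rho> \<sigma> t, of "t + Suc k"] t
    by (intro F.real_cond_exp_intg(2)[symmetric] measurable_generated_algebra) auto
  also have "\<dots> = expectation (\<lambda>w. ?a * (Y t w * Y (t + k) w))"
  proof (rule integral_cong_AE)
    have "AE w in M. real_cond_exp M ?F (Y (t + Suc k)) w = ?a * Y (t + k) w"
      using cond_exp_given_past[OF \<rho> \<sigma>, of "t + k"] t by simp
    then show "AE w in M. Y t w * real_cond_exp M ?F (Y (t + Suc k)) w = ?a * (Y t w * Y (t + k) w)"
      by eventually_elim simp
  qed auto
  also have "\<dots> = ?a * expectation (\<lambda>w. Y t w * Y (t + k) w)" by simp
  finally show ?case by (simp add: Suc.IH mult_ac)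
qed

lemma (in gaussian_convolution_process) corr_eq:
  assumes \<rho>: "-1 < \<rho>" "\<rho> < 1" and \<sigma>: "\<sigma>\<^sub>\<xi> > 0" and t: "t \<ge> 1"
  shows "corr M (Y t) (Y (t + k)) = marginal_sd \<rho> \<sigma>\<^sub>\<xi> t / marginal_sd \<rho> \<sigma>\<^sub>\<xi> (t + k)
    * (\<Prod>j<k. 1 + \<rho> * \<sigma>\<^sub>\<xi> / marginal_sd \<rho> \<sigma>\<^sub>\<xi> (t + j))"
proof -
  have pos: "marginal_sd \<rho> \<sigma>\<^sub>\<xi> t > 0" "marginal_sd \<rho> \<sigma>\<^sub>\<xi> (t + k) > 0"
    using marginal_sd_pos[OF \<rho> \<sigma>] t by auto
  have normal: "distributed M lborel (Y t) (normal_density 0 (marginal_sd \<rho> \<sigma>\<^sub>\<xi> t))"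
    "distributed M lborel (Y (t + k)) (normal_density 0 (marginal_sd \<rho> \<sigma>\<^sub>\<xi> (t + k)))"
    using marginal_normal[OF \<rho> \<sigma>] t by auto
  have mean: "expectation (Y t) = 0" "expectation (Y (t + k)) = 0"
    using normal_distributed_expectation[OF pos(1) normal(1)]
      normal_distributed_expectation[OF pos(2) normal(2)] by auto
  have var: "variance (Y t) = (marginal_sd \<rho> \<sigma>\<^sub>\<xi> t)\<^sup>2"
    "variance (Y (t + k)) = (marginal_sd \<rho> \<sigma>\<^sub>\<xi> (t + k))\<^sup>2"
    using normal_distributed_variance[OF pos(1) normal(1)]
      normal_distributed_variance[OF pos(2) normal(2)] by auto
  show ?thesis
    unfolding corr_def var unfolding mean using pos
    by (simp add: covariance[OF assms] power2_eq_square)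
qed

theorem proposition3p1:
  fixes M :: "'a measure" and Y \<xi> :: "nat \<Rightarrow> 'a \<Rightarrow> real"
    and \<rho> \<sigma>\<^sub>\<xi> :: real and k :: nat
  assumes "\<sigma>\<^sub>\<xi> > 0" and "-1 < \<rho>" and "\<rho> < 0"
    and "gaussian_convolution_process M Y \<xi> \<rho> \<sigma>\<^sub>\<xi>"
    and "k \<ge> 1"
  shows "(\<lambda>t. corr M (Y t) (Y (t + k))) \<longlonglongrightarrow> (1 - 2 * \<rho>\<^sup>2) ^ k"
proof -
  interpret gaussian_convolution_process M Y \<xi> \<rho> \<sigma>\<^sub>\<xi> by fact
  let ?s = "marginal_sd \<rho> \<sigma>\<^sub>\<xi>" and ?L = "- \<sigma>\<^sub>\<xi> / (2 * \<rho>)"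
  have L: "?L \<noteq> 0" using assms by simp
  have lim: "(\<lambda>t. ?s (t + j)) \<longlonglongrightarrow> ?L" for j
    using marginal_sd_tendsto[OF assms(2,3,1)] by (rule LIMSEQ_ignore_initial_segment)
  have "(\<lambda>t. ?s t / ?s (t + k) * (\<Prod>j<k. 1 + \<rho> * \<sigma>\<^sub>\<xi> / ?s (t + j)))
      \<longlonglongrightarrow> ?L / ?L * (\<Prod>j<k. 1 + \<rho> * \<sigma>\<^sub>\<xi> / ?L)"
    using lim[of 0] by (intro tendsto_intros lim L) simp
  moreover have "1 + \<rho> * \<sigma>\<^sub>\<xi> / ?L = 1 - 2 * \<rho>\<^sup>2"
    using assms by (simp add: power2_eq_square)
  ultimately have "(\<lambda>t. ?s t / ?s (t + k) * (\<Prod>j<k. 1 + \<rho> * \<sigma>\<^sub>\<xi> / ?s (t + j)))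
      \<longlonglongrightarrow> (1 - 2 * \<rho>\<^sup>2) ^ k"
    using L by (simp only: prod_constant card_lessThan divide_self mult_1_left not_False_eq_True)
  moreover have "\<forall>\<^sub>F t in sequentially. ?s t / ?s (t + k) * (\<Prod>j<k. 1 + \<rho> * \<sigma>\<^sub>\<xi> / ?s (t + j))
      = corr M (Y t) (Y (t + k))"
    using eventually_ge_at_top[of 1] by eventually_elim (use corr_eq assms in simp)
  ultimately show ?thesis by (rule Lim_transform_eventually)
qed

end
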